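(* For every integer $t_0\geq 1$ and every $\varepsilon>0$, there is a finite graph $G$ for which player $\mathbf{B}$ has a strategy in the Voronoi game on $G$ such that, whatever $\mathbf{A}$ plays, after each of the rounds $k=1,\dots,t_0$ player $\mathbf{B}$ controls at least $(1-\varepsilon)|V(G)|$ vertices, i.e. at least $(1-\varepsilon)|V(G)|$ vertices of $G$ are strictly closer to the set of vertices claimed by $\mathbf{B}$ in the first $k$ rounds than to the set of vertices claimed by $\mathbf{A}$ in the first $k$ rounds.
   Context: The discrete Voronoi game on a finite graph $G$: two players $\mathbf{A}$ and $\mathbf{B}$ alternately claim vertices of $G$, $\mathbf{A}$ first; in each round $\mathbf{A}$ claims one vertex and then $\mathbf{B}$ claims one vertex; no vertex may be claimed twice. Distances are shortest-path distances in $G$; the distance from a vertex to a set is the minimum distance to an element of the set. A player controls a vertex (at a given moment) if it is strictly closer to that player's claimed vertices than to the other player's claimed vertices. *)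

theory Defs
  imports Complex_Main "Graph_Theory.Graph_Theory"
begin

text \<open>
  Finite simple graphs are \<^const>\<open>pair_graph\<close>s, i.e. finite, loop-free and with a symmetric
  arc relation. Vertices in different components are at distance \<open>\<infinity>\<close>.
\<close>

definition graph_dist :: "'a pair_pre_digraph \<Rightarrow> 'a \<Rightarrow> 'a \<Rightarrow> ereal" where
  "graph_dist G u v = wf_digraph.\<mu> (with_proj G) (\<lambda>_. 1) u v"

definition set_dist :: "'a pair_pre_digraph \<Rightarrow> 'a \<Rightarrow> 'a set \<Rightarrow> ereal" where
  "set_dist G v S = (INF s\<in>S. graph_dist G v s)"

text \<open>
  A position of the game is the list of the vertices claimed so far, in order. The indices start
  at 0 and A moves first, so A claims the entries of even index and B those of odd index; after
  \<open>k\<close> rounds the list has length \<open>2 * k\<close>.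
\<close>

definition position :: "'a pair_pre_digraph \<Rightarrow> 'a list \<Rightarrow> bool" where
  "position G xs \<longleftrightarrow> set xs \<subseteq> pverts G \<and> distinct xs"

definition claimed_A :: "'a list \<Rightarrow> 'a set" where
  "claimed_A xs = {xs ! i | i. i < length xs \<and> even i}"

definition claimed_B :: "'a list \<Rightarrow> 'a set" where
  "claimed_B xs = {xs ! i | i. i < length xs \<and> odd i}"

definition controlled_B :: "'a pair_pre_digraph \<Rightarrow> 'a list \<Rightarrow> 'a set" where
  "controlled_B G xs =
     {v \<in> pverts G. set_dist G v (claimed_B xs) < set_dist G v (claimed_A xs)}"

text \<open>
  A strategy of B has to answer every position in which it is B's turn and an unclaimed vertex
  is left.
\<close>

definition strategy_B :: "'a pair_pre_digraph \<Rightarrow> ('a list \<Rightarrow> 'a) \<Rightarrow> bool" where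
  "strategy_B G \<sigma> \<longleftrightarrow>
     (\<forall>xs. position G xs \<and> odd (length xs) \<and> length xs < card (pverts G)
        \<longrightarrow> \<sigma> xs \<in> pverts G - set xs)"

definition follows_B :: "('a list \<Rightarrow> 'a) \<Rightarrow> 'a list \<Rightarrow> bool" where
  "follows_B \<sigma> xs \<longleftrightarrow> (\<forall>i < length xs. odd i \<longrightarrow> xs ! i = \<sigma> (take i xs))"

end

theory Submission
  imports Defs "HOL-Library.Countable"
begin

text \<open>
  Take \<open>m\<close> control vertices, indexed cyclically, and \<open>m\<close> large classes of leaves, such that the
  distance from a leaf of class \<open>c\<close> to the control vertex \<open>i\<close> is a constant plus
  \<open>(i - c) mod m\<close>. The control vertex \<open>i - 1\<close> is then closer than \<open>i\<close> to all classes except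
  class \<open>i\<close>. The distances are realised by long disjoint rods from the classes to the control
  vertices, so that every vertex \<open>x\<close> is, for all classes but one, no better than some control
  vertex \<open>i\<close>; B answers \<open>x\<close> by claiming \<open>i - 1\<close>, or anything if \<open>i - 1\<close> has been claimed.
  Every move of A then costs B at most two of the \<open>m\<close> classes: if \<open>x\<close> is the vertex of A nearest
  to a leaf of another class, then \<open>i - 1\<close> is claimed and closer to the leaf, hence it is B's.
\<close>

section \<open>Distances in graphs\<close>

lemma graph_dist_self:
  assumes "pair_graph G" "u \<in> pverts G"
  shows "graph_dist G u u \<le> 0"
proof -
  interpret pair_graph G by fact
  have "awalk u [] u" using assms by (simp add: awalk_Nil_iff)
  from min_cost_le_walk_cost[OF this, of "\<lambda>_. 1"] show ?thesis
    by (simp add: graph_dist_def zero_ereal_def)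
qed

lemma graph_dist_step:
  assumes "pair_graph G" "(u, v) \<in> parcs G"
  shows "graph_dist G s v \<le> graph_dist G s u + 1"
proof -
  interpret pair_graph G by fact
  have "graph_dist G s v - 1 \<le> ereal (awalk_cost (\<lambda>_. 1) p)" if "awalk s p u" for p
  proof -
    have "awalk u [(u, v)] v"
      using assms by (auto simp: awalk_Cons_iff awalk_Nil_iff dest: wellformed')
    with that have "awalk s (p @ [(u, v)]) v" by (rule awalk_appendI)
    from min_cost_le_walk_cost[OF this, of "\<lambda>_. 1"]
    have "graph_dist G s v \<le> ereal (awalk_cost (\<lambda>_. 1) p) + 1"
      by (simp add: graph_dist_def one_ereal_def)
    then show ?thesis by (simp add: ereal_minus_le)
  qed
  then have "graph_dist G s v - 1 \<le> graph_dist G s u"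
    unfolding graph_dist_def[of G s u] \<mu>_def by (auto intro: INF_greatest)
  then show ?thesis by (simp add: ereal_minus_le)
qed

text \<open>Along a walk \<open>f\<close> grows by at most one per arc, so no walk from
  \<open>u\<close> to \<open>v\<close> is shorter than \<open>f v\<close>; if there is none, the
  distance is infinite. This bounds distances from below without determining shortest walks.\<close>

lemma graph_dist_ge_potential:
  fixes f :: "'a \<Rightarrow> nat"
  assumes "pair_graph G" and step: "\<And>x y. (x, y) \<in> parcs G \<Longrightarrow> f y \<le> f x + 1"
    and "f u = 0"
  shows "ereal (real (f v)) \<le> graph_dist G u v"
proof -
  interpret pair_graph G by fact
  have "real (f v) \<le> real (f u) + awalk_cost (\<lambda>_. 1) p" if "awalk u p v" for p u
    using that
  proof (induction p arbitrary: u)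
    case Nil
    then show ?case by (simp add: awalk_Nil_iff)
  next
    case (Cons e p)
    obtain x y where e: "e = (x, y)" by force
    from Cons.prems e have *: "x = u" "(u, y) \<in> parcs G" "awalk y p v"
      by (auto simp: awalk_Cons_iff)
    show ?case using Cons.IH[OF *(3)] step[OF *(2)] by simp
  qed
  then show ?thesis using \<open>f u = 0\<close>
    unfolding graph_dist_def \<mu>_def by (fastforce intro: INF_greatest)
qed

section \<open>The answering strategy\<close>

lemma set_eq_claimed: "set xs = claimed_A xs \<union> claimed_B xs"
  unfolding claimed_A_def claimed_B_def set_conv_nth by blast

lemma finite_claimed_A: "finite (claimed_A xs)"
  using set_eq_claimed[of xs] by (metis List.finite_set finite_Un)

lemma claimed_A_eq_image: "claimed_A xs = (\<lambda>i. xs ! (2 * i)) ` {i. 2 * i < length xs}"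
  by (auto simp: claimed_A_def elim!: evenE)

lemma card_claimed_A_le:
  assumes "length xs = 2 * k"
  shows "card (claimed_A xs) \<le> k"
proof -
  have "{i. 2 * i < length xs} = {..<k}" using assms by auto
  then show ?thesis unfolding claimed_A_eq_image by (metis card_image_le card_lessThan finite_lessThan)
qed

text \<open>On B's turn \<open>last xs\<close> is the move of A to be answered. The intended vertex
  may have been claimed by either player.\<close>

definition answer :: "'a pair_pre_digraph \<Rightarrow> ('a \<Rightarrow> 'a) \<Rightarrow> 'a list \<Rightarrow> 'a" where
  "answer G r xs =
     (if r (last xs) \<in> set xs then SOME v. v \<in> pverts G - set xs else r (last xs))"

lemma strategy_B_answer:
  assumes "\<And>x. x \<in> pverts G \<Longrightarrow> r x \<in> pverts G"
  shows "strategy_B G (answer G r)"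
  unfolding strategy_B_def
proof (intro allI impI)
  fix xs assume xs: "position G xs \<and> odd (length xs) \<and> length xs < card (pverts G)"
  then have "card (set xs) < card (pverts G)"
    by (simp add: position_def distinct_card)
  then have "\<exists>v. v \<in> pverts G - set xs"
    by (metis Diff_iff List.finite_set card_mono leD subsetI)
  then have "(SOME v. v \<in> pverts G - set xs) \<in> pverts G - set xs" by (rule someI_ex)
  moreover have "last xs \<in> pverts G"
    using xs by (auto simp: position_def intro!: last_in_set[THEN subsetD[rotated]])
  ultimately show "answer G r xs \<in> pverts G - set xs"
    using assms by (auto simp: answer_def)
qed

text \<open>Either \<open>r x\<close> was claimed when A played \<open>x\<close>, or B claims it at
  once. Even length ensures that A's latest move has been answered too.\<close>

lemma answered_claimed:
  assumes "follows_B (answer G r) xs" "even (length xs)" "x \<in> claimed_A xs"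
  shows "r x \<in> set xs"
proof -
  obtain i where i: "i < length xs" "even i" "x = xs ! i"
    using assms(3) by (auto simp: claimed_A_def)
  with assms(2) have i1: "Suc i < length xs"
    by (metis Suc_lessI even_Suc)
  have "xs ! Suc i = answer G r (take (Suc i) xs)"
    using assms(1) i i1 by (auto simp: follows_B_def)
  moreover have "last (take (Suc i) xs) = x"
    using i by (simp add: take_Suc_conv_app_nth)
  ultimately have "r x \<in> set (take (Suc i) xs) \<or> r x = xs ! Suc i"
    by (auto simp: answer_def split: if_splits)
  then show ?thesis using i1 by (auto dest: in_set_takeD)
qed

text \<open>
  The vertex \<open>r x\<close> may itself belong to A; this is why it has to beat \<open>x\<close> strictly.
\<close>

lemma controlled_B_if_answers_closer:
  assumes "v \<in> pverts G" "claimed_A xs \<noteq> {}"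
    and claimed: "\<And>x. x \<in> claimed_A xs \<Longrightarrow> r x \<in> set xs"
    and closer: "\<And>x. x \<in> claimed_A xs \<Longrightarrow> graph_dist G v (r x) < graph_dist G v x"
  shows "v \<in> controlled_B G xs"
proof -
  let ?D = "graph_dist G v ` claimed_A xs"
  have fin: "finite ?D" "?D \<noteq> {}"
    using assms(2) finite_claimed_A[of xs] by auto
  then have "Inf ?D \<in> ?D" by (metis Min_Inf Min_in)
  then obtain x where x: "x \<in> claimed_A xs" "Inf ?D = graph_dist G v x" by auto
  have "r x \<notin> claimed_A xs"
    using closer[OF x(1)] x(2) by (metis INF_lower leD)
  then have "r x \<in> claimed_B xs" using claimed[OF x(1)] set_eq_claimed[of xs] by blast
  then have "set_dist G v (claimed_B xs) \<le> graph_dist G v (r x)"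
    unfolding set_dist_def by (rule INF_lower)
  also have "\<dots> < set_dist G v (claimed_A xs)"
    using closer[OF x(1)] x(2) by (simp add: set_dist_def)
  finally show ?thesis using assms(1) by (simp add: controlled_B_def)
qed

section \<open>The graph\<close>

text \<open>\<open>Rod c i j\<close> is vertex number \<open>j\<close> on the rod from class
  \<open>c\<close> to \<open>Ctrl i\<close>; \<open>Leaf c a\<close> is leaf number \<open>a\<close>
  of class \<open>c\<close>. The game is played on the codes \<open>to_nat\<close> of these
  vertices.\<close>

datatype vertex = Leaf nat nat | Rod nat nat nat | Ctrl nat

instance vertex :: countable
  by countable_datatype

text \<open>The inner \<open>m\<close> avoids truncated subtraction. The outer one keeps all lengths
  in \<open>[m, 2 * m)\<close>, so that a detour through three rods never beats a single
  rod.\<close>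

definition rod_length :: "nat \<Rightarrow> nat \<Rightarrow> nat \<Rightarrow> nat" where
  "rod_length m c i = m + (i + m - c) mod m"

definition cyc_pred :: "nat \<Rightarrow> nat \<Rightarrow> nat" where
  "cyc_pred m i = (i + m - 1) mod m"

lemma rod_length_bounds: "m > 0 \<Longrightarrow> m \<le> rod_length m c i \<and> rod_length m c i < 2 * m"
  by (simp add: rod_length_def)

text \<open>Stepping \<open>i\<close> back lowers the residue of \<open>i - c\<close> by one, unless
  it is 0, that is \<open>i = c\<close>, where it wraps around to \<open>m - 1\<close>. The cases
  only resolve \<open>mod\<close> and the truncated subtraction.\<close>

lemma rod_length_cyc_pred:
  assumes "c < m" "i < m" "c \<noteq> i"
  shows "rod_length m c (cyc_pred m i) < rod_length m c i"
proof (cases "c < i")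
  case True
  then have "cyc_pred m i = i - 1" "(i + m - c) mod m = i - c" "(i - 1 + m - c) mod m = i - 1 - c"
    using assms by (auto simp: cyc_pred_def mod_if)
  then show ?thesis using True by (simp add: rod_length_def)
next
  case False
  show ?thesis
  proof (cases "i = 0")
    case True
    then have "cyc_pred m i = m - 1" "(i + m - c) mod m = m - c" "(m - 1 + m - c) mod m = m - 1 - c"
      using assms by (auto simp: cyc_pred_def mod_if)
    then show ?thesis using assms True by (simp add: rod_length_def)
  next
    case i: False
    then have "cyc_pred m i = i - 1" "(i + m - c) mod m = i + m - c"
      "(i - 1 + m - c) mod m = i - 1 + m - c"
      using assms False by (auto simp: cyc_pred_def mod_if)
    then show ?thesis using assms i by (simp add: rod_length_def)
  qed
qed

definition leaves :: "nat \<Rightarrow> nat \<Rightarrow> vertex set" where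
  "leaves n c = Leaf c ` {..<n}"

text \<open>Everything except the leaves; its size does not depend on \<open>n\<close>, so a large
  \<open>n\<close> makes it negligible. As \<open>j\<close> starts at 0, a rod has
  \<open>rod_length m c i\<close> inner edges, and one more edge at each end gives the distance
  \<open>rod_length m c i + 2\<close>.\<close>

definition skeleton :: "nat \<Rightarrow> vertex set" where
  "skeleton m = Ctrl ` {..<m} \<union> {Rod c i j | c i j. c < m \<and> i < m \<and> j \<le> rod_length m c i}"

definition edges :: "nat \<Rightarrow> nat \<Rightarrow> (vertex \<times> vertex) set" where
  "edges m n =
     {(Leaf c a, Rod c i 0) | c a i. c < m \<and> a < n \<and> i < m} \<union>
     {(Rod c i j, Rod c i (Suc j)) | c i j. c < m \<and> i < m \<and> j < rod_length m c i} \<union>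
     {(Rod c i (rod_length m c i), Ctrl i) | c i. c < m \<and> i < m}"

definition rod_graph :: "nat \<Rightarrow> nat \<Rightarrow> nat pair_pre_digraph" where
  "rod_graph m n =
     \<lparr>pverts = to_nat ` ((\<Union>c<m. leaves n c) \<union> skeleton m),
      parcs = map_prod to_nat to_nat ` (edges m n \<union> (edges m n)\<inverse>)\<rparr>"

lemma finite_skeleton: "finite (skeleton m)"
proof -
  have "skeleton m \<subseteq> Ctrl ` {..<m} \<union>
      (\<lambda>(c, i, j). Rod c i j) ` ({..<m} \<times> {..<m} \<times> {..2 * m})"
  proof
    fix x assume "x \<in> skeleton m"
    then consider i where "x = Ctrl i" "i < m"
      | c i j where "x = Rod c i j" "c < m" "i < m" "j \<le> rod_length m c i"
      by (auto simp: skeleton_def)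
    then show "x \<in> Ctrl ` {..<m} \<union>
      (\<lambda>(c, i, j). Rod c i j) ` ({..<m} \<times> {..<m} \<times> {..2 * m})"
    proof cases
      case 2
      then have "j \<le> 2 * m" using rod_length_bounds[of m c i] by linarith
      then show ?thesis using 2 by (force intro!: UnI2 image_eqI[of _ _ "(c, i, j)"])
    qed simp
  qed
  then show ?thesis by (rule finite_subset) simp
qed

lemma finite_vertices: "finite ((\<Union>c<m. leaves n c) \<union> skeleton m)"
  by (auto simp: leaves_def finite_skeleton)

lemma edges_subset:
  "edges m n \<subseteq> ((\<Union>c<m. leaves n c) \<union> skeleton m) \<times> ((\<Union>c<m. leaves n c) \<union> skeleton m)"
  by (auto simp: edges_def leaves_def skeleton_def)

lemma pair_graph_rod_graph: "pair_graph (rod_graph m n)"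
proof
  let ?V = "(\<Union>c<m. leaves n c) \<union> skeleton m"
  fix e assume e: "e \<in> parcs (rod_graph m n)"
  then obtain u v where uv: "e = (to_nat u, to_nat v)" "(u, v) \<in> edges m n \<union> (edges m n)\<inverse>"
    by (auto simp: rod_graph_def)
  then have "u \<in> ?V" "v \<in> ?V" using edges_subset[of m n] by blast+
  then show "fst e \<in> pverts (rod_graph m n)" "snd e \<in> pverts (rod_graph m n)"
    unfolding rod_graph_def uv by simp_all
  from uv(2) have "u \<noteq> v" by (auto simp: edges_def)
  then show "fst e \<noteq> snd e" by (simp add: uv)
next
  show "finite (pverts (rod_graph m n))"
    by (simp only: rod_graph_def pair_pre_digraph.simps finite_imageI finite_vertices)
  have "finite (edges m n)"
    using edges_subset finite_vertices by (meson finite_SigmaI finite_subset)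
  then show "finite (parcs (rod_graph m n))"
    by (simp add: rod_graph_def)
  show "symmetric (with_proj (rod_graph m n))"
    by (auto simp: rod_graph_def symmetric_def intro!: symI image_eqI[where x = "(_, _)"])
qed

lemma card_rod_graph:
  "card (pverts (rod_graph m n)) = m * n + card (skeleton m)"
proof -
  have "card (pverts (rod_graph m n)) = card ((\<Union>c<m. leaves n c) \<union> skeleton m)"
    unfolding rod_graph_def by (simp add: card_image)
  also have "\<dots> = card (\<Union>c<m. leaves n c) + card (skeleton m)"
    by (intro card_Un_disjoint finite_skeleton) (auto simp: leaves_def skeleton_def)
  also have "card (\<Union>c<m. leaves n c) = m * n"
    by (subst card_UN_disjoint) (auto simp: leaves_def card_image inj_on_def)
  finally show ?thesis .
qed

lemma card_leaves_UN:
  assumes "finite C"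
  shows "card (to_nat ` (\<Union>c\<in>C. leaves n c)) = card C * n"
proof -
  have "card (\<Union>c\<in>C. leaves n c) = card C * n"
    using assms by (subst card_UN_disjoint) (auto simp: leaves_def card_image inj_on_def)
  then show ?thesis by (simp add: card_image)
qed

section \<open>Distances from the leaves\<close>

lemma graph_dist_leaf_ctrl_le:
  assumes "c < m" "i < m" "a < n"
  shows "graph_dist (rod_graph m n) (to_nat (Leaf c a)) (to_nat (Ctrl i))
    \<le> ereal (real (rod_length m c i + 2))"
proof -
  let ?d = "\<lambda>v. graph_dist (rod_graph m n) (to_nat (Leaf c a)) (to_nat v)"
  have step: "?d v \<le> ereal (real (Suc k))"
    if "?d u \<le> ereal (real k)" "(u, v) \<in> edges m n" for u v k
  proof -
    have "(to_nat u, to_nat v) \<in> parcs (rod_graph m n)"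
      using that(2) by (auto simp: rod_graph_def)
    from graph_dist_step[OF pair_graph_rod_graph this]
    have "?d v \<le> ?d u + 1" .
    also have "\<dots> \<le> ereal (real k) + 1" using that(1) by (rule add_right_mono)
    finally show ?thesis by (simp add: one_ereal_def add.commute)
  qed
  have "?d (Leaf c a) \<le> ereal (real 0)"
    using graph_dist_self[OF pair_graph_rod_graph, of "to_nat (Leaf c a)" m n] assms
    by (auto simp: rod_graph_def leaves_def zero_ereal_def)
  then have 0: "?d (Rod c i 0) \<le> ereal (real (Suc 0))"
    by (rule step) (use assms in \<open>auto simp: edges_def\<close>)
  have "?d (Rod c i j) \<le> ereal (real (Suc j))" if "j \<le> rod_length m c i" for j
    using that
  proof (induction j)
    case (Suc j)
    show ?case
      by (rule step[OF Suc.IH]) (use assms Suc.prems in \<open>auto simp: edges_def\<close>)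
  qed (rule 0)
  from step[OF this[OF order_refl], of "Ctrl i"] assms show ?thesis
    by (simp add: edges_def)
qed

text \<open>
  A lower bound, exact at the control vertices, for the distance from the leaves of class \<open>c\<close>.
\<close>

fun potential :: "nat \<Rightarrow> nat \<Rightarrow> vertex \<Rightarrow> nat" where
  "potential m c (Leaf b a) = (if b = c then 0 else 2 * m + 2)"
| "potential m c (Rod b i j) =
     (if b = c then j + 1 else max (rod_length m c i + 2) (2 * m + 2 - j))"
| "potential m c (Ctrl i) = rod_length m c i + 2"

text \<open>On a rod of another class the potential starts at \<open>2 * m + 2\<close>, the value at
  the foreign leaves, and falls by at most one per vertex to the value at \<open>Ctrl i\<close>. It
  gets there in time because the rod has length at least \<open>m\<close>.\<close>

lemma potential_edge:
  assumes "(u, v) \<in> edges m n"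
  shows "potential m c u \<le> potential m c v + 1 \<and> potential m c v \<le> potential m c u + 1"
proof -
  have "m > 0" using assms by (auto simp: edges_def)
  from assms consider
    b a i where "u = Leaf b a" "v = Rod b i 0"
    | b i j where "u = Rod b i j" "v = Rod b i (Suc j)"
    | b i where "u = Rod b i (rod_length m b i)" "v = Ctrl i"
    by (auto simp: edges_def)
  then show ?thesis
  proof cases
    case 1
    then show ?thesis using rod_length_bounds[OF \<open>m > 0\<close>, of c i] by auto
  next
    case 2
    then show ?thesis by auto
  next
    case 3
    then show ?thesis
      using rod_length_bounds[OF \<open>m > 0\<close>, of c i] rod_length_bounds[OF \<open>m > 0\<close>, of b i] by auto
  qed
qed

lemma potential_le_graph_dist:
  "ereal (real (potential m c v)) \<le> graph_dist (rod_graph m n) (to_nat (Leaf c a)) (to_nat v)"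
proof -
  have "potential m c (from_nat y) \<le> potential m c (from_nat x) + 1"
    if "(x, y) \<in> parcs (rod_graph m n)" for x y
    using that potential_edge[of _ _ m n c] by (auto simp: rod_graph_def)
  from graph_dist_ge_potential[OF pair_graph_rod_graph, of m n "\<lambda>x. potential m c (from_nat x)",
      OF this, of "to_nat (Leaf c a)" "to_nat v"]
  show ?thesis by simp
qed

text \<open>
  The control vertex that is at least as good as \<open>v\<close> for all classes other than
  \<open>home v\<close>.
\<close>

fun delegate :: "vertex \<Rightarrow> nat" where
  "delegate (Leaf c a) = 0"
| "delegate (Rod c i j) = i"
| "delegate (Ctrl i) = i"

fun home :: "vertex \<Rightarrow> nat" where
  "home (Leaf c a) = c"
| "home (Rod c i j) = c"
| "home (Ctrl i) = i"

text \<open>A leaf of another class has potential \<open>2 * m + 2\<close>, more than any control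
  vertex, so the delegate 0 of leaves is an arbitrary choice.\<close>

lemma potential_ge_delegate:
  assumes "m > 0" "c \<noteq> home v"
  shows "rod_length m c (delegate v) + 2 \<le> potential m c v"
  using assms rod_length_bounds[of m c 0] by (cases v) auto

section \<open>B's replies and the leaves they secure\<close>

definition reply :: "nat \<Rightarrow> nat \<Rightarrow> nat" where
  "reply m x = to_nat (Ctrl (cyc_pred m (delegate (from_nat x))))"

text \<open>Two classes are excluded: for its home class \<open>x\<close> may be nearer than its
  delegate, and for the class numbered like the delegate the step back wraps around to the longest
  rod.\<close>

lemma reply_closer:
  assumes "c < m" "a < n" "x \<in> pverts (rod_graph m n)"
    and "c \<noteq> home (from_nat x)" "c \<noteq> delegate (from_nat x)"
  shows "graph_dist (rod_graph m n) (to_nat (Leaf c a)) (reply m x)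
    < graph_dist (rod_graph m n) (to_nat (Leaf c a)) x"
proof -
  obtain v where v: "x = to_nat v" "v \<in> (\<Union>c<m. leaves n c) \<union> skeleton m"
    using assms(3) by (auto simp: rod_graph_def)
  define i where "i = delegate v"
  have i: "i < m" "cyc_pred m i < m"
    using v(2) assms(1) by (auto simp: i_def cyc_pred_def leaves_def skeleton_def)
  have "graph_dist (rod_graph m n) (to_nat (Leaf c a)) (reply m x)
      \<le> ereal (real (rod_length m c (cyc_pred m i) + 2))"
    using graph_dist_leaf_ctrl_le[OF assms(1) i(2) assms(2)] by (simp add: reply_def v i_def)
  also have "\<dots> < ereal (real (rod_length m c i + 2))"
    using rod_length_cyc_pred[OF assms(1) i(1)] assms(5) by (simp add: i_def v)
  also have "\<dots> \<le> ereal (real (potential m c v))"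
    using potential_ge_delegate[of m c v] assms by (simp add: i_def v)
  also have "\<dots> \<le> graph_dist (rod_graph m n) (to_nat (Leaf c a)) x"
    unfolding v by (rule potential_le_graph_dist)
  finally show ?thesis .
qed

lemma card_controlled_B_rod_graph:
  assumes xs: "position (rod_graph m n) xs" "length xs = 2 * k" "k \<ge> 1"
    and "follows_B (answer (rod_graph m n) (reply m)) xs"
  shows "(m - 2 * k) * n \<le> card (controlled_B (rod_graph m n) xs)"
proof -
  let ?G = "rod_graph m n"
  define A where "A = claimed_A xs"
  \<comment> \<open>Each vertex of A spoils at most these two classes; all leaves of the remaining
    ones are B's.\<close>
  define bad where "bad = (home \<circ> from_nat) ` A \<union> (delegate \<circ> from_nat) ` A"
  have "xs ! 0 \<in> A" using xs by (force simp: A_def claimed_A_def)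
  then have A: "finite A" "card A \<le> k" "A \<noteq> {}" "A \<subseteq> pverts ?G"
    using set_eq_claimed[of xs] card_claimed_A_le[OF xs(2)] xs(1) finite_claimed_A[of xs]
    by (auto simp: A_def position_def)
  have "card bad \<le> 2 * k"
    using card_Un_le[of "(home \<circ> from_nat) ` A" "(delegate \<circ> from_nat) ` A"]
      card_image_le[OF A(1), of "home \<circ> from_nat"] card_image_le[OF A(1), of "delegate \<circ> from_nat"]
      A(2) unfolding bad_def by linarith
  moreover have "finite bad" using A(1) by (simp add: bad_def)
  ultimately have "m - 2 * k \<le> card ({..<m} - bad)"
    using diff_card_le_card_Diff[of bad "{..<m}"] by simp
  then have "(m - 2 * k) * n \<le> card (to_nat ` (\<Union>c\<in>{..<m} - bad. leaves n c))"
    by (simp add: card_leaves_UN)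
  also have "\<dots> \<le> card (controlled_B ?G xs)"
  proof (rule card_mono)
    have "finite (pverts ?G)"
      by (simp only: rod_graph_def pair_pre_digraph.simps finite_imageI finite_vertices)
    then show "finite (controlled_B ?G xs)"
      by (rule finite_subset[rotated]) (auto simp: controlled_B_def)
    show "to_nat ` (\<Union>c\<in>{..<m} - bad. leaves n c) \<subseteq> controlled_B ?G xs"
    proof clarify
      fix v c assume c: "c < m" "c \<notin> bad" and "v \<in> leaves n c"
      then obtain a where v: "v = Leaf c a" "a < n" by (auto simp: leaves_def)
      show "to_nat v \<in> controlled_B ?G xs"
      proof (rule controlled_B_if_answers_closer)
        show "to_nat v \<in> pverts ?G" using c v by (auto simp: rod_graph_def leaves_def)
        show "claimed_A xs \<noteq> {}" using A(3) by (simp add: A_def)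
        fix x assume x: "x \<in> claimed_A xs"
        show "reply m x \<in> set xs"
          using answered_claimed[OF assms(4) _ x] xs(2) by simp
        show "graph_dist ?G (to_nat v) (reply m x) < graph_dist ?G (to_nat v) x"
          unfolding v(1) using c x A(4)
          by (intro reply_closer v) (auto simp: A_def bad_def)
      qed
    qed
  qed
  finally show ?thesis .
qed

theorem theorem3:
  fixes t0 :: nat and \<epsilon> :: real
  assumes "t0 \<ge> 1" and "\<epsilon> > 0"
  shows "\<exists>(G :: nat pair_pre_digraph) \<sigma>.
    pair_graph G \<and> 2 * t0 \<le> card (pverts G) \<and> strategy_B G \<sigma> \<and>
    (\<forall>k\<in>{1..t0}. \<forall>xs. position G xs \<and> follows_B \<sigma> xs \<and> length xs = 2 * k \<longrightarrow>
       real (card (controlled_B G xs)) \<ge> (1 - \<epsilon>) * real (card (pverts G)))"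
proof -
  \<comment> \<open>Each half of \<epsilon> pays for one loss: \<open>m\<close> makes the at most
    \<open>2 * t0\<close> spoiled classes cost at most \<epsilon>/2 of the \<open>m * n\<close>
    leaves, and \<open>n\<close>, chosen once \<open>R\<close> is fixed, does the same for the whole
    skeleton.\<close>
  define m where "m = max (2 * t0) (nat \<lceil>4 * real t0 / \<epsilon>\<rceil>)"
  define R where "R = card (skeleton m)"
  define n where "n = max 1 (nat \<lceil>2 * real R / \<epsilon>\<rceil>)"
  let ?G = "rod_graph m n"
  have m: "2 * t0 \<le> m" "4 * real t0 \<le> \<epsilon> * real m"
  proof -
    have "4 * real t0 / \<epsilon> \<le> real m" unfolding m_def by linarith
    then show "4 * real t0 \<le> \<epsilon> * real m" using \<open>\<epsilon> > 0\<close> by (simp add: field_simps)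
  qed (simp add: m_def)
  have n: "1 \<le> n" "2 * real R \<le> \<epsilon> * real n"
  proof -
    have "2 * real R / \<epsilon> \<le> real n" unfolding n_def by linarith
    then show "2 * real R \<le> \<epsilon> * real n" using \<open>\<epsilon> > 0\<close> by (simp add: field_simps)
  qed (simp add: n_def)
  have cardV: "card (pverts ?G) = m * n + R" by (simp add: card_rod_graph R_def)
  have "1 * real n \<le> real m * real n"
    using m(1) assms(1) by (intro mult_right_mono) auto
  then have "2 * real R \<le> \<epsilon> * (real m * real n)"
    using n(2) mult_left_mono[of "1 * real n" "real m * real n" \<epsilon>] \<open>\<epsilon> > 0\<close> by linarith
  moreover have "4 * real t0 * real n \<le> \<epsilon> * real m * real n"
    using m(2) by (rule mult_right_mono) simp
  ultimately have loss: "2 * real t0 * real n + real R \<le> \<epsilon> * (real m * real n)"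
    by simp
  have "strategy_B ?G (answer ?G (reply m))"
    using m(1) assms(1)
    by (intro strategy_B_answer) (auto simp: reply_def rod_graph_def skeleton_def cyc_pred_def)
  \<comment> \<open>Enough vertices for all \<open>t0\<close> rounds to be played; this is where
    \<open>n\<close> must be positive.\<close>
  moreover have "2 * t0 \<le> card (pverts ?G)"
    using m(1) mult_le_mono2[OF n(1), of m] unfolding cardV by linarith
  moreover have "(1 - \<epsilon>) * real (card (pverts ?G)) \<le> real (card (controlled_B ?G xs))"
    if k: "k \<in> {1..t0}" and xs: "position ?G xs" "follows_B (answer ?G (reply m)) xs"
      "length xs = 2 * k" for k xs
  proof -
    have "(1 - \<epsilon>) * real (card (pverts ?G))
        = real m * real n + real R - \<epsilon> * (real m * real n) - \<epsilon> * real R"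
      by (simp add: cardV algebra_simps)
    also have "\<dots> \<le> real m * real n - 2 * real t0 * real n"
      using loss \<open>\<epsilon> > 0\<close> mult_nonneg_nonneg[of \<epsilon> "real R"] by linarith
    also have "\<dots> = real ((m - 2 * t0) * n)"
      using m(1) by (simp add: of_nat_diff algebra_simps)
    also have "\<dots> \<le> real ((m - 2 * k) * n)"
      using k by (intro of_nat_mono mult_le_mono1) auto
    also have "\<dots> \<le> real (card (controlled_B ?G xs))"
      using card_controlled_B_rod_graph[of m n xs k] k xs by (intro of_nat_mono) auto
    finally show ?thesis .
  qed
  ultimately show ?thesis using pair_graph_rod_graph[of m n] by blast
qed

end
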